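(* Let $\sigma^0=(+,-,-,-,-,-,+,+,+,+,+,-)$ be the sign pattern of length $12$. There exists no real monic polynomial $P(x)=x^{11}+a_{10}x^{10}+\cdots+a_1x+a_0$ whose coefficients have the signs prescribed by $\sigma^0$ (i.e. $a_{10},a_9,a_8,a_7,a_6<0$, $a_5,a_4,a_3,a_2,a_1>0$, $a_0<0$) and which has exactly one positive root and exactly eight negative roots, all of them simple (and hence a pair of complex conjugate non-real roots). In other words, the sign pattern $\sigma^0$ is not realizable with the admissible pair $(1,8)$.
   Context: A sign pattern is a finite sequence of $\pm$ signs with leading sign $+$; a polynomial $x^d+a_{d-1}x^{d-1}+\cdots+a_0$ with all coefficients nonzero defines the sign pattern consisting of the signs of its coefficients, listed from $x^d$ down to $x^0$. A sign pattern $\sigma$ is realizable with a pair $(pos,neg)$ if some monic real polynomial with sign pattern $\sigma$ has exactly $pos$ positive and exactly $neg$ negative roots, all simple. *)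

theory Defs
  imports "HOL-Computational_Algebra.Polynomial"
begin

text \<open>A sign pattern is a list of signs (True = +, False = -), listed from the
  leading coefficient x^d down to x^0; its first entry must be +.\<close>

definition has_sign_pattern :: "real poly \<Rightarrow> bool list \<Rightarrow> bool" where
  "has_sign_pattern p \<sigma> \<longleftrightarrow>
     length \<sigma> = degree p + 1 \<and>
     (\<forall>i\<le>degree p. (if \<sigma> ! (degree p - i) then coeff p i > 0 else coeff p i < 0))"

definition realizable :: "bool list \<Rightarrow> nat \<Rightarrow> nat \<Rightarrow> bool" where
  "realizable \<sigma> pos neg \<longleftrightarrow>
     (\<exists>p :: real poly. lead_coeff p = 1 \<and> has_sign_pattern p \<sigma> \<and>
        card {x. x > 0 \<and> poly p x = 0} = pos \<and>
        card {x. x < 0 \<and> poly p x = 0} = neg \<and>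
        (\<forall>x. poly p x = 0 \<longrightarrow> order x p = 1))"

definition sigma0 :: "bool list" where
  "sigma0 = [True, False, False, False, False, False, True, True, True, True, True, False]"

end

theory Submission
  imports Defs
begin

text \<open>
  Factor the polynomial as \<open>(x - \<rho>) (x\<^sup>2 + a x + b) \<Prod>(x + u\<^sub>i)\<close> with eight \<open>u\<^sub>i > 0\<close> and
  \<open>a\<^sup>2 < 4 b\<close>. The signs of the coefficients of \<open>x\<^sup>1\<^sup>0\<close> and \<open>x\<close> bound \<open>- a\<close> and \<open>- a / b\<close> from below;
  if both \<open>\<Sum>u\<^sub>i \<ge> 3 \<rho>\<close> and \<open>\<Sum>1/u\<^sub>i \<ge> 3 / \<rho>\<close>, their product already exceeds \<open>4\<close>.
  The substitution \<open>x \<mapsto> 1/x\<close> swaps the two sums, so let \<open>\<Sum>1/u\<^sub>i < 3 / \<rho>\<close>.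
  The conditions on the coefficients of \<open>x\<^sup>1\<^sup>0\<close> and \<open>x\<^sup>6\<close> are linear in \<open>a\<close> and \<open>b\<close>; multiplying them
  and using \<open>a\<^sup>2 < 4 b\<close> eliminates both and leaves
  \<open>m\<^sub>2\<^sub>1\<^sub>1 + \<rho>\<^sup>2 e\<^sub>2 < \<rho> m\<^sub>2\<^sub>1\<close> for the elementary and monomial symmetric functions of the \<open>u\<^sub>i\<close>.
  But each \<open>u\<^sub>i\<close> is at least \<open>\<rho> / 3\<close>, which forces \<open>m\<^sub>2\<^sub>1\<^sub>1 \<ge> \<rho> m\<^sub>2\<^sub>1\<close>.
\<close>

section \<open>Elementary symmetric functions\<close>

text \<open>e_k is read off its generating function: inserting an index multiplies by one linear
  factor, and the values past \<open>card I\<close> vanish by themselves.\<close>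

definition esym :: "('i \<Rightarrow> real) \<Rightarrow> 'i set \<Rightarrow> nat \<Rightarrow> real" where
  "esym f I k = coeff (\<Prod>i\<in>I. [:1, f i:]) k"

lemma esym_empty: "esym f {} k = (if k = 0 then 1 else 0)"
  by (simp add: esym_def)

lemma esym_0 [simp]: "esym f I 0 = 1"
  by (simp add: esym_def poly_0_coeff_0[symmetric] poly_prod)

lemma esym_insert:
  assumes "finite I" "x \<notin> I"
  shows "esym f (insert x I) (Suc k) = esym f I (Suc k) + f x * esym f I k"
  using assms by (simp add: esym_def)

lemma esym_nonneg:
  assumes "finite I" "\<And>i. i \<in> I \<Longrightarrow> f i \<ge> 0"
  shows "esym f I k \<ge> 0"
  using assms
proof (induction I arbitrary: k rule: finite_induct)
  case empty
  then show ?case by (simp add: esym_empty)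
next
  case (insert x I)
  then show ?case by (cases k) (simp_all add: esym_insert)
qed

lemma esym_1: "finite I \<Longrightarrow> esym f I 1 = sum f I"
  by (induction I rule: finite_induct) (simp_all add: esym_empty esym_insert)

text \<open>Expanding the right side, \<open>1 / f i\<close> cancels a factor of every product
  containing \<open>f i\<close>; each k-fold product arises \<open>card I - k\<close> times, and the
  other terms are nonnegative.\<close>

lemma sum_inverse_mult_esym_ge:
  assumes "finite I" "\<And>i. i \<in> I \<Longrightarrow> f i > 0"
  shows "(real (card I) - real k) * esym f I k \<le> (\<Sum>i\<in>I. 1 / f i) * esym f I (Suc k)"
  using assms
proof (induction I arbitrary: k rule: finite_induct)
  case empty
  then show ?case by (simp add: esym_empty)
next
  case (insert x I)
  define S where "S = (\<Sum>i\<in>I. 1 / f i)"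
  define E where "E = esym f I"
  have x: "f x > 0" using insert.prems by simp
  have IH: "(real (card I) - real k) * E k \<le> S * E (Suc k)" for k
    unfolding S_def E_def using insert.IH insert.prems by simp
  have E: "E k \<ge> 0" for k
    unfolding E_def using insert.hyps insert.prems by (intro esym_nonneg) (auto intro: less_imp_le)
  have S: "S \<ge> 0"
    unfolding S_def using insert.prems by (intro sum_nonneg) (auto intro: less_imp_le)
  have sum: "(\<Sum>i\<in>insert x I. 1 / f i) = S + 1 / f x"
    using insert.hyps by (simp add: S_def)
  have card: "real (card (insert x I)) = real (card I) + 1"
    using insert.hyps by simp
  show ?case
  proof (cases k)
    case 0
    have "E 0 = 1" by (simp add: E_def)
    then have "real (card I) + 1 \<le> S * E 1 + 1"
      using IH[of 0] by simp
    also have "\<dots> \<le> S * E 1 + 1 + (S * f x + E 1 / f x)"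
      using S x E by simp
    also have "\<dots> = (S + 1 / f x) * (E 1 + f x)"
      using x by (simp add: field_simps)
    finally show ?thesis
      using 0 insert.hyps by (simp add: sum card esym_insert E_def[symmetric] \<open>E 0 = 1\<close>)
  next
    case (Suc j)
    have "f x * ((real (card I) - real j) * E j) \<le> f x * (S * E (Suc j))"
      using IH[of j] x by (simp add: mult_left_mono)
    moreover have "E (Suc (Suc j)) / f x \<ge> 0"
      using E x by simp
    moreover have "(S + 1 / f x) * (E (Suc (Suc j)) + f x * E (Suc j)) =
        S * E (Suc (Suc j)) + f x * (S * E (Suc j)) + E (Suc (Suc j)) / f x + E (Suc j)"
      using x by (simp add: field_simps)
    moreover have "(real (card I) + 1 - real (Suc j)) * (E (Suc j) + f x * E j) =
        (real (card I) - real (Suc j)) * E (Suc j) + E (Suc j) + f x * ((real (card I) - real j) * E j)"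
      by (simp add: algebra_simps)
    ultimately have "(real (card I) + 1 - real (Suc j)) * (E (Suc j) + f x * E j)
        \<le> (S + 1 / f x) * (E (Suc (Suc j)) + f x * E (Suc j))"
      using IH[of "Suc j"] by linarith
    then show ?thesis
      using insert.hyps by (simp only: Suc sum card esym_insert E_def not_False_eq_True)
  qed
qed

text \<open>In the next three lemmas \<open>e\<^sub>1\<^sup>2 - 2 e\<^sub>2\<close>, \<open>e\<^sub>1 e\<^sub>2 - 3 e\<^sub>3\<close> and \<open>e\<^sub>1 e\<^sub>3 - 4 e\<^sub>4\<close> are the monomial
  symmetric functions \<open>m\<^sub>2\<close>, \<open>m\<^sub>2\<^sub>1\<close> and \<open>m\<^sub>2\<^sub>1\<^sub>1\<close>.\<close>

lemma esym_2_ge: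
  assumes "finite I" "\<And>i. i \<in> I \<Longrightarrow> f i \<ge> d" "d \<ge> 0"
  shows "(real (card I) - 1) * d * esym f I 1 \<le> 2 * esym f I 2"
  using assms(1,2)
proof (induction I rule: finite_induct)
  case empty
  then show ?case by (simp add: esym_empty)
next
  case (insert x I)
  define n where "n = real (card I)"
  define e1 where "e1 = esym f I 1"
  define e2 where "e2 = esym f I 2"
  have x: "f x \<ge> d" using insert.prems by simp
  have IH: "(n - 1) * d * e1 \<le> 2 * e2"
    unfolding n_def e1_def e2_def using insert.IH insert.prems by simp
  have e1: "n * d \<le> e1"
    unfolding n_def e1_def esym_1[OF insert.hyps(1)]
    using insert.prems by (intro sum_bounded_below) auto
  moreover have "0 \<le> n * d" using \<open>d \<ge> 0\<close> by (simp add: n_def)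
  ultimately have "d * e1 \<le> f x * e1" "f x * (n * d) \<le> f x * e1"
    using x \<open>d \<ge> 0\<close> by (auto intro!: mult_right_mono mult_left_mono)
  then have "n * d * (e1 + f x) \<le> 2 * (e2 + f x * e1)"
    using IH by (simp add: algebra_simps)
  then show ?case
    using insert.hyps
    by (simp add: numeral_2_eq_2 esym_insert n_def e1_def e2_def)
qed

text \<open>m21 sums \<open>(f i)^2 * f j\<close> over ordered pairs of distinct indices; bounding
  \<open>f j\<close> below by \<open>d\<close> leaves \<open>card I - 1\<close> copies of each
  square. The sign of m2 is carried along because the induction step compares \<open>d * m2\<close>
  with \<open>f x * m2\<close>.\<close>

lemma msym_21_ge:
  assumes "finite I" "\<And>i. i \<in> I \<Longrightarrow> f i \<ge> d" "d \<ge> 0"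
  shows "(real (card I) - 1) * d * ((esym f I 1)\<^sup>2 - 2 * esym f I 2)
    \<le> esym f I 1 * esym f I 2 - 3 * esym f I 3 \<and> 0 \<le> (esym f I 1)\<^sup>2 - 2 * esym f I 2"
  using assms(1,2)
proof (induction I rule: finite_induct)
  case empty
  then show ?case by (simp add: esym_empty)
next
  case (insert x I)
  define n where "n = real (card I)"
  define e1 where "e1 = esym f I 1"
  define e2 where "e2 = esym f I 2"
  define e3 where "e3 = esym f I 3"
  define m2 where "m2 = e1\<^sup>2 - 2 * e2"
  have x: "f x \<ge> d" using insert.prems by simp
  have IH: "(n - 1) * d * m2 \<le> e1 * e2 - 3 * e3" "0 \<le> m2"
    unfolding n_def e1_def e2_def e3_def m2_def using insert.IH insert.prems by simp_all
  have e1: "n * d \<le> e1"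
    unfolding n_def e1_def esym_1[OF insert.hyps(1)]
    using insert.prems by (intro sum_bounded_below) auto
  have ins: "esym f (insert x I) 1 = e1 + f x" "esym f (insert x I) 2 = e2 + f x * e1"
    "esym f (insert x I) 3 = e3 + f x * e2"
    using insert.hyps
    by (simp_all add: numeral_2_eq_2 numeral_3_eq_3 esym_insert e1_def e2_def e3_def)
  have m2': "(e1 + f x)\<^sup>2 - 2 * (e2 + f x * e1) = m2 + (f x)\<^sup>2"
    by (simp add: m2_def power2_eq_square algebra_simps)
  have "d * m2 \<le> f x * m2" "(f x)\<^sup>2 * (n * d) \<le> (f x)\<^sup>2 * e1"
    using x IH e1 by (auto intro!: mult_right_mono mult_left_mono)
  moreover have "(e1 + f x) * (e2 + f x * e1) - 3 * (e3 + f x * e2) =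
      e1 * e2 - 3 * e3 + f x * m2 + (f x)\<^sup>2 * e1"
    by (simp add: m2_def power2_eq_square algebra_simps)
  moreover have "n * d * (m2 + (f x)\<^sup>2) = (n - 1) * d * m2 + d * m2 + (f x)\<^sup>2 * (n * d)"
    by (simp add: algebra_simps)
  ultimately have "n * d * (m2 + (f x)\<^sup>2) \<le> (e1 + f x) * (e2 + f x * e1) - 3 * (e3 + f x * e2)"
    using IH by linarith
  then show ?case
    unfolding ins m2' using insert.hyps IH by (simp add: n_def)
qed

text \<open>Twice m211 sums \<open>(f i)^2 * f j * f k\<close> over ordered triples of distinct
  indices; bounding \<open>f k\<close> below by \<open>d\<close> yields each term of m21
  \<open>card I - 2\<close> times.\<close>

lemma msym_211_ge:
  assumes "finite I" "\<And>i. i \<in> I \<Longrightarrow> f i \<ge> d" "d \<ge> 0"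
  shows "(real (card I) - 2) * d * (esym f I 1 * esym f I 2 - 3 * esym f I 3)
    \<le> 2 * (esym f I 1 * esym f I 3 - 4 * esym f I 4)"
  using assms(1,2)
proof (induction I rule: finite_induct)
  case empty
  then show ?case by (simp add: esym_empty)
next
  case (insert x I)
  define n where "n = real (card I)"
  define e1 where "e1 = esym f I 1"
  define e2 where "e2 = esym f I 2"
  define e3 where "e3 = esym f I 3"
  define e4 where "e4 = esym f I 4"
  define m2 where "m2 = e1\<^sup>2 - 2 * e2"
  define m21 where "m21 = e1 * e2 - 3 * e3"
  have x: "f x \<ge> d" using insert.prems by simp
  have IH: "(n - 2) * d * m21 \<le> 2 * (e1 * e3 - 4 * e4)"
    unfolding n_def e1_def e2_def e3_def e4_def m21_def using insert.IH insert.prems by simp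
  have m21: "(n - 1) * d * m2 \<le> m21" "0 \<le> m2"
    unfolding n_def e1_def e2_def e3_def m2_def m21_def
    using msym_21_ge[of I d f] insert.hyps insert.prems \<open>d \<ge> 0\<close> by auto
  have e2: "(n - 1) * d * e1 \<le> 2 * e2"
    unfolding n_def e1_def e2_def
    using esym_2_ge[of I d f] insert.hyps insert.prems \<open>d \<ge> 0\<close> by auto
  have m21_nonneg: "0 \<le> m21"
  proof (cases "I = {}")
    case True
    then show ?thesis by (simp add: m21_def e1_def e2_def e3_def esym_empty)
  next
    case False
    then have "n \<ge> 1"
      using insert.hyps by (simp add: n_def Suc_le_eq card_gt_0_iff)
    then have "0 \<le> (n - 1) * d * m2"
      using m21 \<open>d \<ge> 0\<close> by simp
    then show ?thesis using m21 by linarith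
  qed
  have ins: "esym f (insert x I) 1 = e1 + f x" "esym f (insert x I) 2 = e2 + f x * e1"
    "esym f (insert x I) 3 = e3 + f x * e2" "esym f (insert x I) 4 = e4 + f x * e3"
    using insert.hyps
    by (simp_all add: eval_nat_numeral esym_insert e1_def e2_def e3_def e4_def)
  \<comment> \<open>Inserting \<open>x\<close> adds \<open>f x * m21 + (f x)^2 * e2\<close> to m211.
    Of the doubled \<open>f x * m21\<close>, one copy pays for \<open>d * m21\<close>, the other for
    the m2 term.\<close>
  have "d * m21 \<le> f x * m21" "f x * ((n - 1) * d * m2) \<le> f x * m21"
    "(f x)\<^sup>2 * ((n - 1) * d * e1) \<le> (f x)\<^sup>2 * (2 * e2)"
    using x m21 m21_nonneg e2 \<open>d \<ge> 0\<close> by (auto intro!: mult_right_mono mult_left_mono)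
  then have "(n - 2) * d * m21 + d * m21 + f x * ((n - 1) * d * m2) + (f x)\<^sup>2 * ((n - 1) * d * e1)
      \<le> 2 * (e1 * e3 - 4 * e4) + 2 * (f x * m21) + (f x)\<^sup>2 * (2 * e2)"
    using IH by linarith
  then have "(n - 1) * d * (m21 + f x * m2 + (f x)\<^sup>2 * e1)
      \<le> 2 * (e1 * e3 - 4 * e4 + f x * m21 + (f x)\<^sup>2 * e2)"
    by (simp add: algebra_simps)
  moreover have "(e1 + f x) * (e3 + f x * e2) - 4 * (e4 + f x * e3) =
      e1 * e3 - 4 * e4 + f x * m21 + (f x)\<^sup>2 * e2"
    by (simp add: m21_def power2_eq_square algebra_simps)
  moreover have "(e1 + f x) * (e2 + f x * e1) - 3 * (e3 + f x * e2) =
      m21 + f x * m2 + (f x)\<^sup>2 * e1"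
    by (simp add: m2_def m21_def power2_eq_square algebra_simps)
  ultimately have "(n - 1) * d * ((e1 + f x) * (e2 + f x * e1) - 3 * (e3 + f x * e2))
      \<le> 2 * ((e1 + f x) * (e3 + f x * e2) - 4 * (e4 + f x * e3))"
    by (simp only:)
  then show ?case
    unfolding ins using insert.hyps by (simp add: n_def)
qed

section \<open>Polynomials with prescribed roots\<close>

text \<open>The factors have constant term 1, so coefficient k of \<open>F\<close> is that of
  \<open>x^(card I + 3 - k)\<close> in the monic product with the reversed factors.\<close>

lemma cubic_times_esym_coeffs:
  fixes f :: "'i \<Rightarrow> real" and I :: "'i set" and \<rho> a b :: real
  defines "F \<equiv> [:1, - \<rho>:] * [:1, a, b:] * (\<Prod>i\<in>I. [:1, f i:])"
  shows "coeff (F) 1 = esym f I 1 + a - \<rho>"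
    and "coeff (F) 5 = (esym f I 5 - \<rho> * esym f I 4) + a * (esym f I 4 - \<rho> * esym f I 3)
      + b * (esym f I 3 - \<rho> * esym f I 2)"
proof -
  have F: "F = [:1, - \<rho>:] * ([:1, a, b:] * (\<Prod>i\<in>I. [:1, f i:]))"
    by (simp only: F_def mult.assoc)
  show "coeff (F) 1 = esym f I 1 + a - \<rho>"
    unfolding F using esym_0[of f I]
    by (simp add: coeff_pCons esym_def)
  show "coeff (F) 5 = (esym f I 5 - \<rho> * esym f I 4) + a * (esym f I 4 - \<rho> * esym f I 3)
      + b * (esym f I 3 - \<rho> * esym f I 2)"
    unfolding F by (simp add: coeff_pCons eval_nat_numeral esym_def algebra_simps)
qed

text \<open>Stated for arbitrary data so that it serves both the polynomial itself and its image
  under x -> 1/x.\<close>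

lemma no_sign_pattern_if_sum_inverse_small:
  fixes f :: "'i \<Rightarrow> real" and I :: "'i set" and a b \<rho> :: real
  defines "F \<equiv> [:1, - \<rho>:] * [:1, a, b:] * (\<Prod>i\<in>I. [:1, f i:])"
  assumes I: "finite I" "card I = 8" and f: "\<And>i. i \<in> I \<Longrightarrow> f i > 0"
    and rho: "\<rho> > 0" and disc: "a\<^sup>2 < 4 * b"
    and small: "\<rho> * (\<Sum>i\<in>I. 1 / f i) \<le> 3"
    and c1: "coeff F 1 < 0" and c5: "coeff F 5 < 0"
  shows False
proof -
  define e where "e = esym f I"
  define S where "S = (\<Sum>i\<in>I. 1 / f i)"
  have fge: "f i \<ge> \<rho> / 3" if "i \<in> I" for i
  proof -
    have "1 / f i \<le> S"
      unfolding S_def using that f I by (intro member_le_sum) (auto intro: less_imp_le)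
    then have "\<rho> * (1 / f i) \<le> \<rho> * S"
      using rho by (intro mult_left_mono) auto
    then have "\<rho> / f i \<le> 3"
      using small by (simp add: S_def)
    then show ?thesis
      using f[OF that] by (simp add: field_simps)
  qed
  have e_nonneg: "e k \<ge> 0" for k
    unfolding e_def using I f by (intro esym_nonneg) (auto intro: less_imp_le)
  \<comment> \<open>Here \<open>8 - k\<close> is at least 3, which matches the bound 3 on
    \<open>\<rho> * S\<close>.\<close>
  have ratio: "\<rho> * e k \<le> e (Suc k)" if "k \<le> 5" for k
  proof -
    have "3 * e k \<le> (8 - real k) * e k"
      using that e_nonneg by (intro mult_right_mono) auto
    also have "\<dots> \<le> S * e (Suc k)"
      using sum_inverse_mult_esym_ge[OF I(1) f, where k = k] I(2) by (simp add: S_def e_def)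
    finally have "\<rho> * (3 * e k) \<le> \<rho> * (S * e (Suc k))"
      using rho by (intro mult_left_mono) auto
    also have "\<dots> = (\<rho> * S) * e (Suc k)" by simp
    also have "\<dots> \<le> 3 * e (Suc k)"
      using small e_nonneg by (intro mult_right_mono) (auto simp: S_def)
    finally show ?thesis by simp
  qed
  have "real (card I) * (\<rho> / 3) \<le> sum f I"
    using fge by (intro sum_bounded_below) auto
  then have e1: "e 1 > \<rho>"
    unfolding e_def esym_1[OF I(1)] using I rho by simp
  have b: "b > 0"
    using disc zero_le_power2[of a] by linarith
  \<comment> \<open>The condition on coefficient 5 becomes \<open>X + a * T < 0\<close>. As
    \<open>X\<close> is nonnegative and \<open>a\<close> negative, this forces
    \<open>T > 0\<close>.\<close>
  define T where "T = e 4 - \<rho> * e 3"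
  define X where "X = (e 5 - \<rho> * e 4) + b * (e 3 - \<rho> * e 2)"
  have X_ge: "b * (e 3 - \<rho> * e 2) \<le> X" and X_nonneg: "0 \<le> X"
    using ratio[of 4] ratio[of 2] b by (simp_all add: X_def eval_nat_numeral)
  have X_less: "X < - a * T"
    using c5 unfolding F_def cubic_times_esym_coeffs
    by (simp add: X_def T_def e_def algebra_simps)
  have a: "e 1 - \<rho> < - a"
    using c1 unfolding F_def cubic_times_esym_coeffs by (simp add: e_def)
  have T: "0 < T"
    using X_nonneg X_less a e1 by (smt (verit) mult_nonneg_nonpos)
  \<comment> \<open>Multiplying \<open>X < - a * T\<close> by \<open>e 1 - \<rho> < - a\<close>
    produces \<open>a^2\<close>, which the discriminant bound trades for \<open>4 * b\<close>; then
    \<open>b\<close> cancels.\<close>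
  have "b * ((e 3 - \<rho> * e 2) * (e 1 - \<rho>)) \<le> X * (e 1 - \<rho>)"
    using X_ge e1 mult_right_mono[of "b * (e 3 - \<rho> * e 2)" X "e 1 - \<rho>"] by (simp add: mult.assoc)
  also have "\<dots> \<le> (- a * T) * (- a)"
    using X_less X_nonneg a e1 T by (intro mult_mono) auto
  also have "\<dots> = a\<^sup>2 * T"
    by (simp add: power2_eq_square)
  also have "\<dots> < 4 * b * T"
    using disc T by simp
  finally have "b * ((e 3 - \<rho> * e 2) * (e 1 - \<rho>)) < b * (4 * T)"
    by simp
  then have key: "(e 3 - \<rho> * e 2) * (e 1 - \<rho>) < 4 * T"
    using b by simp
  \<comment> \<open>With eight indices and \<open>d = \<rho> / 3\<close> the factor
    \<open>(8 - 2) * d\<close> is \<open>2 * \<rho>\<close>, so the 2 cancels.\<close>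
  have "\<rho> * (e 1 * e 2 - 3 * e 3) \<le> e 1 * e 3 - 4 * e 4"
    using msym_211_ge[of I "\<rho> / 3" f] fge rho I by (simp add: e_def)
  moreover have "0 \<le> \<rho>\<^sup>2 * e 2"
    using e_nonneg by simp
  ultimately show False
    using key by (simp add: T_def power2_eq_square algebra_simps)
qed

lemma no_sign_pattern_factored:
  fixes u :: "'i \<Rightarrow> real" and I :: "'i set" and a b \<rho> :: real
  defines "P \<equiv> [:- \<rho>, 1:] * [:b, a, 1:] * (\<Prod>i\<in>I. [:u i, 1:])"
  assumes I: "finite I" "card I = 8" and u: "\<And>i. i \<in> I \<Longrightarrow> u i > 0"
    and rho: "\<rho> > 0" and disc: "a\<^sup>2 < 4 * b"
    and c: "coeff P 10 < 0" "coeff P 6 < 0" "coeff P 5 > 0" "coeff P 1 > 0"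
  shows False
proof -
  \<comment> \<open>\<open>F\<close> is \<open>P\<close> reversed; \<open>G\<close> is
    \<open>P\<close> divided by its constant term \<open>- m\<close>, whose sign turns the positive
    coefficients of x^5 and x into negative ones.\<close>
  define F where "F = [:1, - \<rho>:] * [:1, a, b:] * (\<Prod>i\<in>I. [:1, u i:])"
  define G where "G = [:1, - (1 / \<rho>):] * [:1, a / b, 1 / b:] * (\<Prod>i\<in>I. [:1, 1 / u i:])"
  define m where "m = \<rho> * b * (\<Prod>i\<in>I. u i)"
  have b: "b > 0"
    using disc zero_le_power2[of a] by linarith
  have m: "m > 0"
    using rho b u by (simp add: m_def prod_pos)
  have "(\<Prod>i\<in>I. [:u i, 1:]) = (\<Prod>i\<in>I. smult (u i) [:1, 1 / u i:])"
    using u by (intro prod.cong) force+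
  also have "\<dots> = smult (\<Prod>i\<in>I. u i) (\<Prod>i\<in>I. [:1, 1 / u i:])"
    by (rule prod_smult)
  finally have prod: "(\<Prod>i\<in>I. [:u i, 1:]) = \<dots>" .
  have lin: "[:- \<rho>, 1:] = smult (- \<rho>) [:1, - (1 / \<rho>):]" and quad: "[:b, a, 1:] = smult b [:1, a / b, 1 / b:]"
    using rho b by simp_all
  have PG: "P = smult (- m) G"
    unfolding P_def G_def prod lin quad by (simp only: mult_smult_left mult_smult_right smult_smult m_def) (simp add: mult_ac)
  have "(\<Prod>i\<in>I. reflect_poly [:u i, 1:]) = (\<Prod>i\<in>I. [:1, u i:])"
    using u by (intro prod.cong) (force simp: reflect_poly_pCons)+
  moreover have "reflect_poly [:- \<rho>, 1:] = [:1, - \<rho>:]" "reflect_poly [:b, a, 1:] = [:1, a, b:]"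
    using rho b by (simp_all add: reflect_poly_pCons)
  ultimately have "reflect_poly P = F"
    by (simp only: P_def F_def reflect_poly_mult reflect_poly_prod)
  moreover have "degree P = 11"
    unfolding P_def using I
    by (subst degree_mult_eq; (subst degree_mult_eq)?)
      (simp_all add: degree_prod_eq_sum_degree del: mult_pCons_left mult_pCons_right)
  ultimately have F_coeff: "coeff F 1 < 0" "coeff F 5 < 0"
    using c by (auto simp: coeff_reflect_poly)
  have G_coeff: "coeff G 1 < 0" "coeff G 5 < 0"
    using c(3,4) m by (simp_all add: PG zero_less_mult_iff mult_less_0_iff)
  have F1: "sum u I + a - \<rho> < 0"
    using F_coeff(1) unfolding F_def cubic_times_esym_coeffs esym_1[OF I(1)] .
  have G1: "(\<Sum>i\<in>I. 1 / u i) + a / b - 1 / \<rho> < 0"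
    using G_coeff(1) unfolding G_def cubic_times_esym_coeffs esym_1[OF I(1)] .
  show False
  proof (cases "\<rho> * (\<Sum>i\<in>I. 1 / u i) \<le> 3")
    case True
    then show False
      using no_sign_pattern_if_sum_inverse_small[OF I u rho disc] F_coeff by (simp add: F_def)
  next
    case not_small: False
    show False
    proof (cases "(1 / \<rho>) * sum u I \<le> 3")
      case True
      have "(a / b)\<^sup>2 < 4 * (1 / b)"
        using disc b by (simp add: field_simps power2_eq_square)
      then show False
        using no_sign_pattern_if_sum_inverse_small[of I "\<lambda>i. 1 / u i" "1 / \<rho>" "a / b" "1 / b"]
          I u rho True G_coeff by (simp add: G_def)
    next
      \<comment> \<open>Both sums now exceed three times their unit, \<open>\<rho>\<close> or
        \<open>1 / \<rho>\<close>. Hence \<open>- a > 2 * \<rho>\<close> and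
        \<open>- a / b > 2 / \<rho>\<close>, so \<open>a^2 > 4 * b\<close>.\<close>
      case False
      then have "2 * \<rho> < - a"
        using F1 rho by (simp add: field_simps)
      moreover have "2 * b < - a * \<rho>"
      proof -
        have "3 / \<rho> < (\<Sum>i\<in>I. 1 / u i)"
          using not_small rho by (simp add: field_simps)
        then have "2 / \<rho> < - (a / b)"
          using G1 by (simp add: field_simps)
        then show ?thesis using rho b by (simp add: field_simps)
      qed
      moreover from calculation(1) have "2 * \<rho> * (- a) < - a * (- a)"
        using rho by (intro mult_strict_right_mono) auto
      ultimately show False
        using disc by (simp add: power2_eq_square mult_ac)
    qed
  qed
qed

section \<open>Splitting off the real roots\<close>

lemma prod_linear_factors_dvd:
  fixes p :: "'a::idom poly"
  assumes "finite A" "\<And>x. x \<in> A \<Longrightarrow> poly p x = 0"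
  shows "(\<Prod>x\<in>A. [:- x, 1:]) dvd p"
  using assms
proof (induction A rule: finite_induct)
  case empty
  then show ?case by simp
next
  case (insert x A)
  then obtain q where q: "p = (\<Prod>x\<in>A. [:- x, 1:]) * q"
    by (auto elim: dvdE)
  moreover have "poly (\<Prod>x\<in>A. [:- x, 1:]) x \<noteq> 0"
    using insert.hyps by (auto simp: poly_prod)
  ultimately have "poly q x = 0"
    using insert.prems[of x] by simp
  then obtain r where "q = [:- x, 1:] * r"
    by (auto simp: poly_eq_0_iff_dvd elim: dvdE)
  then show ?case
    using q insert.hyps by (simp add: mult_ac del: mult_pCons_left mult_pCons_right)
qed

lemma monic_quadratic_disc_neg:
  fixes a b :: real
  assumes "\<And>x. poly [:b, a, 1:] x \<noteq> 0"
  shows "a\<^sup>2 < 4 * b"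
proof (rule ccontr)
  assume "\<not> a\<^sup>2 < 4 * b"
  then have "(sqrt (a\<^sup>2 - 4 * b))\<^sup>2 = a\<^sup>2 - 4 * b"
    by simp
  then have "poly [:b, a, 1:] ((- a + sqrt (a\<^sup>2 - 4 * b)) / 2) = 0"
    by (simp add: field_simps power2_eq_square)
  with assms show False by blast
qed

theorem theorem1:
  shows "\<not> realizable sigma0 1 8"
proof
  assume "realizable sigma0 1 8"
  then obtain p :: "real poly" where lead: "lead_coeff p = 1"
    and sign: "has_sign_pattern p sigma0"
    and pos: "card {x. x > 0 \<and> poly p x = 0} = 1"
    and neg: "card {x. x < 0 \<and> poly p x = 0} = 8"
    and simple: "\<And>x. poly p x = 0 \<Longrightarrow> order x p = 1"
    unfolding realizable_def by blast
  have deg: "degree p = 11"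
    using sign by (simp add: has_sign_pattern_def sigma0_def)
  have coeffs: "if sigma0 ! (11 - i) then coeff p i > 0 else coeff p i < 0" if "i \<le> 11" for i
    using sign that by (simp add: has_sign_pattern_def deg)
  have c: "coeff p 10 < 0" "coeff p 6 < 0" "coeff p 5 > 0" "coeff p 1 > 0" "coeff p 0 < 0"
    using coeffs[of 10] coeffs[of 6] coeffs[of 5] coeffs[of 1] coeffs[of 0]
    by (simp_all add: sigma0_def)
  have p0: "p \<noteq> 0" using lead by auto
  define N where "N = {x. x < 0 \<and> poly p x = 0}"
  obtain \<rho> where rho: "{x. x > 0 \<and> poly p x = 0} = {\<rho>}"
    using pos by (auto simp: card_1_singleton_iff)
  then have rho_pos: "\<rho> > 0" and rho_root: "poly p \<rho> = 0" by auto
  \<comment> \<open>An infinite set has \<open>card\<close> 0, so the value 8 gives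
    finiteness.\<close>
  have N: "finite N" "card N = 8"
    using neg by (auto simp: N_def intro: card_ge_0_finite)
  define A where "A = insert \<rho> N"
  have A: "finite A" "\<rho> \<notin> N"
    using N rho_pos by (auto simp: A_def N_def)
  \<comment> \<open>Zero is not a root because the constant coefficient is negative.\<close>
  have A_iff: "x \<in> A \<longleftrightarrow> poly p x = 0" for x
  proof (cases x "0 :: real" rule: linorder_cases)
    case equal
    then show ?thesis using c(5) rho_pos by (auto simp: A_def N_def poly_0_coeff_0)
  next
    case greater
    then show ?thesis using rho by (auto simp: A_def N_def)
  qed (use rho_pos in \<open>auto simp: A_def N_def\<close>)
  define L where "L = (\<Prod>x\<in>A. [:- x, 1:])"
  obtain q where q: "p = L * q"
    using prod_linear_factors_dvd[of A p] A A_iff unfolding L_def by (auto elim: dvdE)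
  have "degree L = 9"
    unfolding L_def using A N by (subst degree_prod_eq_sum_degree) (auto simp: A_def)
  then have "degree q = 2"
    using q p0 deg degree_mult_eq[of L q] by auto
  moreover have "lead_coeff L = 1"
    by (simp add: L_def lead_coeff_prod)
  then have "lead_coeff q = 1"
    using lead q by (simp add: lead_coeff_mult)
  ultimately obtain a b where ab: "q = [:b, a, 1:]"
    by (elim degree2_coeffs) (simp split: if_splits)
  \<comment> \<open>A real root of \<open>q\<close> would also be a root of \<open>L\<close>, hence
    a double root of \<open>p\<close>.\<close>
  have "poly q x \<noteq> 0" for x
  proof
    assume x: "poly q x = 0"
    then have "poly p x = 0" by (simp add: q)
    then have "x \<in> A" using A_iff by simp
    then have "[:- x, 1:] dvd L"
      unfolding L_def using A by (intro dvd_prodI) auto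
    then have "[:- x, 1:] ^ 2 dvd p"
      using x unfolding q power2_eq_square by (intro mult_dvd_mono) (simp_all add: poly_eq_0_iff_dvd)
    then have "order x p \<ge> 2"
      using p0 by (simp add: order_divides)
    with simple[OF \<open>poly p x = 0\<close>] show False by simp
  qed
  then have disc: "a\<^sup>2 < 4 * b"
    unfolding ab by (rule monic_quadratic_disc_neg)
  have "p = [:- \<rho>, 1:] * [:b, a, 1:] * (\<Prod>x\<in>N. [:- x, 1:])"
    unfolding q ab L_def A_def prod.insert[OF N(1) A(2)] by (simp only: mult_ac)
  then show False
    using no_sign_pattern_factored[of N "\<lambda>x. - x" \<rho> a b] N rho_pos disc c
    by (simp add: N_def)
qed

end
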